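(* Let $a\in\mathbb{C}$, let $U\subset\mathbb{C}$ be open, and let $[0,1]\ni\tau\mapsto\gamma(\tau)$ be a contour. (1) Suppose that, for every $z\in U$, $$e^{t^2}(t-z)^{-a-1}\Big|_{t=\gamma(0)}^{t=\gamma(1)}=0.$$ Then, for $z\in U$, $$\big(\partial_z^2-2z\partial_z-2a\big)\int_\gamma e^{t^2}(t-z)^{-a}\,dt=0.$$ (2) Suppose that, for every $z\in U$, $$e^{-t^2-2zt}t^{a}\Big|_{t=\gamma(0)}^{t=\gamma(1)}=0.$$ Then, for $z\in U$, $$\big(\partial_z^2-2z\partial_z-2a\big)\int_\gamma e^{-t^2-2zt}t^{a-1}\,dt=0.$$
   Context: The operator $\mathcal{S}(a;z,\partial_z):=\partial_z^2-2z\partial_z-2a$ is the Hermite operator. Notation: $f(t)\big|_{t=\gamma(0)}^{t=\gamma(1)}$ denotes $f(\gamma(1))-f(\gamma(0))$, where multivalued functions are continued analytically along $\gamma$ (so for a closed contour the two values may differ). Conventions on contours: $\gamma$ does not depend on $z\in U$; it is piecewise smooth on $]0,1[$ and there avoids the singularities of the integrand (in (1): all $z\in U$; in (2): $0$). The branch of the power is fixed by a continuous choice of the logarithm of $t-z$ (in (1), holomorphic in $z\in U$), respectively of $t$ (in (2)), along $\gamma$, the same in the integrand and in the boundary condition. Endpoints may be singular points or infinity, in which case values there mean limits along $\gamma$. The integral is assumed to converge and to be twice differentiable in $z\in U$ under the integral sign. *)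

theory Defs
  imports "HOL-Analysis.Analysis"
begin

text \<open>
  A contour is given by its values on the open interval \<open>]0,1[\<close>; at both ends it converges in
  the Riemann sphere, so that an endpoint may be the point at infinity.  The values
  \<open>\<gamma> 0\<close> and \<open>\<gamma> 1\<close> are never used.  Breakpoints may accumulate only at the ends.
\<close>

definition contour :: "(real \<Rightarrow> complex) \<Rightarrow> bool" where
  "contour \<gamma> \<longleftrightarrow>
     (\<forall>c d. 0 < c \<and> c < d \<and> d < 1 \<longrightarrow> \<gamma> piecewise_C1_differentiable_on {c..d}) \<and>
     ((\<exists>p. (\<gamma> \<longlongrightarrow> p) (at_right 0)) \<or> filterlim \<gamma> at_infinity (at_right 0)) \<and>
     ((\<exists>q. (\<gamma> \<longlongrightarrow> q) (at_left 1)) \<or> filterlim \<gamma> at_infinity (at_left 1))"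

text \<open>
  Multivalued functions of \<open>t\<close> continued along \<open>\<gamma>\<close> are functions \<open>h\<close> of the parameter.
  The gauge integral over \<open>]0,1[\<close> includes conditionally convergent improper integrals
  (Hake's theorem).  Where \<open>\<gamma>\<close> has a breakpoint, the value of \<open>vector_derivative\<close> is
  irrelevant, as there are only countably many such points.
\<close>

definition integral_along :: "(real \<Rightarrow> complex) \<Rightarrow> (real \<Rightarrow> complex) \<Rightarrow> complex" where
  "integral_along \<gamma> h = integral {0<..<1} (\<lambda>\<tau>. h \<tau> * vector_derivative \<gamma> (at \<tau>))"

definition converges_along :: "(real \<Rightarrow> complex) \<Rightarrow> (real \<Rightarrow> complex) \<Rightarrow> bool" where
  "converges_along \<gamma> h \<longleftrightarrow> (\<lambda>\<tau>. h \<tau> * vector_derivative \<gamma> (at \<tau>)) integrable_on {0<..<1}"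

definition twice_diff_under_integral ::
    "(real \<Rightarrow> complex) \<Rightarrow> complex set \<Rightarrow> (complex \<Rightarrow> real \<Rightarrow> complex) \<Rightarrow> bool" where
  "twice_diff_under_integral \<gamma> U h \<longleftrightarrow> (\<forall>z\<in>U.
     converges_along \<gamma> (\<lambda>\<tau>. deriv (\<lambda>w. h w \<tau>) z) \<and>
     converges_along \<gamma> (\<lambda>\<tau>. (deriv ^^ 2) (\<lambda>w. h w \<tau>) z) \<and>
     ((\<lambda>w. integral_along \<gamma> (h w)) has_field_derivative
        integral_along \<gamma> (\<lambda>\<tau>. deriv (\<lambda>w. h w \<tau>) z)) (at z) \<and>
     ((\<lambda>v. integral_along \<gamma> (\<lambda>\<tau>. deriv (\<lambda>w. h w \<tau>) v)) has_field_derivative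
        integral_along \<gamma> (\<lambda>\<tau>. (deriv ^^ 2) (\<lambda>w. h w \<tau>) z)) (at z))"

text \<open>
  \<open>has_boundary_diff h D\<close> says that \<open>h\<close>, taken between the two ends of the contour, is \<open>D\<close>.
  At a regular endpoint the one-sided limit is the value of the continued function there.
\<close>

definition has_boundary_diff :: "(real \<Rightarrow> complex) \<Rightarrow> complex \<Rightarrow> bool" where
  "has_boundary_diff h D \<longleftrightarrow>
     (\<exists>u v. (h \<longlongrightarrow> u) (at_right 0) \<and> (h \<longlongrightarrow> v) (at_left 1) \<and> D = v - u)"

definition log_branch :: "(real \<Rightarrow> complex) \<Rightarrow> (real \<Rightarrow> complex) \<Rightarrow> bool" where
  "log_branch g l \<longleftrightarrow> continuous_on {0<..<1} l \<and> (\<forall>\<tau>\<in>{0<..<1}. exp (l \<tau>) = g \<tau>)"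

text \<open>The power determined by a choice \<open>l\<close> of the logarithm of the base.\<close>

definition branch_power :: "complex \<Rightarrow> complex \<Rightarrow> complex" where
  "branch_power l b = exp (b * l)"

definition hermite_op :: "complex \<Rightarrow> (complex \<Rightarrow> complex) \<Rightarrow> complex \<Rightarrow> complex" where
  "hermite_op a F z = (deriv ^^ 2) F z - 2 * z * deriv F z - 2 * a * F z"

end

theory Submission
  imports Defs
begin

text \<open>
  Applied to either integrand, the Hermite operator in \<open>z\<close> gives an exact derivative along the
  contour: with \<open>D\<close> for the derivative in \<open>t\<close>,
    \<open>(\<partial>\<^sub>z\<^sup>2 - 2 z \<partial>\<^sub>z - 2 a) (e^(t\<^sup>2) (t-z)^(-a)) = D (-a e^(t\<^sup>2) (t-z)^(-a-1))\<close>
  and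
    \<open>(\<partial>\<^sub>z\<^sup>2 - 2 z \<partial>\<^sub>z - 2 a) (e^(-t\<^sup>2-2zt) t^(a-1)) = D (-2 e^(-t\<^sup>2-2zt) t^a)\<close>.
  The operator may be moved under the integral sign, so the value is the boundary difference of
  the primitive, a constant multiple of the quantity that is assumed to vanish.

  Two points need care.  The fundamental theorem of calculus has to hold for a conditionally
  convergent integral over an open contour, possibly with infinitely many breakpoints; this is
  \<open>integral_along_eq_boundary_diff\<close>.  And the chosen logarithm, along the
  contour merely a continuous function, has to be differentiated; this is
  \<open>has_derivative_log_branch\<close>, which also yields the derivative in \<open>z\<close>.
\<close>

section \<open>Integrals of exact derivatives along a contour\<close>

text \<open>
  On each \<open>{c..d}\<close> inside \<open>]0,1[\<close> there are finitely many breakpoints, and the usual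
  fundamental theorem shows that the indefinite integral and the primitive \<open>G\<close> differ by a
  constant.  The gauge integral is continuous in its limits up to the ends of \<open>[0,1]\<close>, so the
  constant disappears in the difference of the two one-sided limits.
\<close>

lemma integral_along_eq_boundary_diff:
  fixes G k :: "real \<Rightarrow> complex"
  assumes \<gamma>: "contour \<gamma>"
    and conv: "converges_along \<gamma> k"
    and cont: "continuous_on {0<..<1} G"
    and deriv: "\<And>\<tau> D. \<tau> \<in> {0<..<1} \<Longrightarrow> (\<gamma> has_vector_derivative D) (at \<tau>)
                  \<Longrightarrow> (G has_vector_derivative k \<tau> * D) (at \<tau>)"
    and bd: "has_boundary_diff G D"
  shows "integral_along \<gamma> k = D"
proof -
  define f where "f = (\<lambda>\<tau>. k \<tau> * vector_derivative \<gamma> (at \<tau>))"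
  define I where "I = (\<lambda>x. integral {0..x} f)"
  have int01: "f integrable_on {0..1}"
    using conv by (simp add: converges_along_def f_def integrable_on_Icc_iff_Ioo)
  have diff: "I d - I c = G d - G c" if cd: "0 < c" "c < d" "d < 1" for c d
  proof -
    from \<gamma> cd have "\<gamma> piecewise_C1_differentiable_on {c..d}"
      by (simp add: contour_def)
    then obtain S where S: "finite S" "\<gamma> C1_differentiable_on ({c..d} - S)"
      by (auto simp: piecewise_C1_differentiable_on_def)
    have "(f has_integral (G d - G c)) {c..d}"
    proof (rule fundamental_theorem_of_calculus_interior_strong[OF S(1)])
      fix x assume x: "x \<in> {c<..<d} - S"
      then obtain E where E: "(\<gamma> has_vector_derivative E) (at x)"
        using S(2) unfolding C1_differentiable_on_def by fastforce
      with x cd show "(G has_vector_derivative f x) (at x)"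
        using deriv[OF _ E] vector_derivative_at[OF E] by (simp add: f_def)
    next
      show "continuous_on {c..d} G"
        by (rule continuous_on_subset[OF cont]) (use cd in auto)
    qed (use cd in simp)
    moreover have "I c + integral {c..d} f = I d"
      unfolding I_def
    proof (rule Henstock_Kurzweil_Integration.integral_combine)
      show "f integrable_on {0..d}"
        using cd by (intro integrable_subinterval_real[OF int01]) auto
    qed (use cd in auto)
    ultimately show ?thesis
      by (simp add: integral_unique algebra_simps)
  qed
  define K where "K = I (1/2) - G (1/2)"
  have const: "G x = I x - K" if x: "x \<in> {0<..<1}" for x
  proof (cases x "1/2 :: real" rule: linorder_cases)
    case less
    then show ?thesis using diff[of x "1/2"] x by (simp add: K_def algebra_simps)
  next
    case equal
    show ?thesis unfolding K_def equal by simp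
  next
    case greater
    then show ?thesis using diff[of "1/2" x] x by (simp add: K_def algebra_simps)
  qed
  have contI: "continuous_on {0..1} I"
    unfolding I_def by (rule indefinite_integral_continuous_1[OF int01])
  have "(I \<longlongrightarrow> I 0) (at_right 0)" "(I \<longlongrightarrow> I 1) (at_left 1)"
    using contI by (auto simp: continuous_on_Icc_at_rightD continuous_on_Icc_at_leftD)
  moreover have "\<forall>\<^sub>F x in at_right 0. I x - K = G x"
    using eventually_at_right_real[of 0 1] by (auto elim!: eventually_mono simp: const)
  moreover have "\<forall>\<^sub>F x in at_left 1. I x - K = G x"
    using eventually_at_left_real[of 0 1] by (auto elim!: eventually_mono simp: const)
  ultimately have "(G \<longlongrightarrow> I 0 - K) (at_right 0)" "(G \<longlongrightarrow> I 1 - K) (at_left 1)"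
    by (blast intro: Lim_transform_eventually tendsto_diff tendsto_const)+
  moreover obtain u v where "(G \<longlongrightarrow> u) (at_right 0)" "(G \<longlongrightarrow> v) (at_left 1)" "D = v - u"
    using bd by (auto simp: has_boundary_diff_def)
  ultimately have "D = (I 1 - K) - (I 0 - K)"
    using tendsto_unique trivial_limit_at_right_real trivial_limit_at_left_real by metis
  then show ?thesis
    by (simp add: I_def integral_along_def f_def integral_open_interval_real)
qed

text \<open>
  Since both differentiations pass under the integral sign, the Hermite operator applied to
  the integral is the integral of the operator applied to the integrand.  When that is the derivative of
  \<open>G\<close> along the contour, \<open>integral_along_eq_boundary_diff\<close> evaluates it.
\<close>

lemma hermite_op_integral_along_exact:
  fixes G :: "real \<Rightarrow> complex" and h h1 h2 :: "complex \<Rightarrow> real \<Rightarrow> complex"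
  assumes U: "open U" "z \<in> U" and \<gamma>: "contour \<gamma>"
    and conv: "\<And>w. w \<in> U \<Longrightarrow> converges_along \<gamma> (h w)"
    and tw: "twice_diff_under_integral \<gamma> U h"
    and h1: "\<And>w \<tau>. w \<in> U \<Longrightarrow> \<tau> \<in> {0<..<1} \<Longrightarrow> ((\<lambda>w. h w \<tau>) has_field_derivative h1 w \<tau>) (at w)"
    and h2: "\<And>w \<tau>. w \<in> U \<Longrightarrow> \<tau> \<in> {0<..<1} \<Longrightarrow> ((\<lambda>w. h1 w \<tau>) has_field_derivative h2 w \<tau>) (at w)"
    and cont: "continuous_on {0<..<1} G"
    and exact: "\<And>\<tau> D. \<tau> \<in> {0<..<1} \<Longrightarrow> (\<gamma> has_vector_derivative D) (at \<tau>)
      \<Longrightarrow> (G has_vector_derivative (h2 z \<tau> - 2 * z * h1 z \<tau> - 2 * a * h z \<tau>) * D) (at \<tau>)"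
    and bd: "has_boundary_diff G 0"
  shows "hermite_op a (\<lambda>w. integral_along \<gamma> (h w)) z = 0"
proof -
  define F where "F = (\<lambda>w. integral_along \<gamma> (h w))"
  define F1 where "F1 = (\<lambda>w. integral_along \<gamma> (\<lambda>\<tau>. deriv (\<lambda>w. h w \<tau>) w))"
  define p where "p = (\<lambda>\<tau>. vector_derivative \<gamma> (at \<tau>))"
  have d1: "deriv (\<lambda>w. h w \<tau>) w = h1 w \<tau>" if "w \<in> U" "\<tau> \<in> {0<..<1}" for w \<tau>
    using h1[OF that] by (rule DERIV_imp_deriv)
  have d2: "(deriv ^^ 2) (\<lambda>w. h w \<tau>) z = h2 z \<tau>" if "\<tau> \<in> {0<..<1}" for \<tau>
  proof -
    have "\<forall>\<^sub>F w in nhds z. deriv (\<lambda>w. h w \<tau>) w = h1 w \<tau>"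
      using U d1 that by (auto simp: eventually_nhds)
    then have "deriv (deriv (\<lambda>w. h w \<tau>)) z = deriv (\<lambda>w. h1 w \<tau>) z"
      by (rule deriv_cong_ev) simp
    then show ?thesis
      using DERIV_imp_deriv[OF h2[OF U(2) that]] by (simp add: numeral_2_eq_2)
  qed
  have DF: "deriv F w = F1 w" if "w \<in> U" for w
    using tw that unfolding twice_diff_under_integral_def F_def F1_def
    by (blast intro: DERIV_imp_deriv)
  have "\<forall>\<^sub>F w in nhds z. deriv F w = F1 w"
    using U DF by (auto simp: eventually_nhds)
  then have "deriv (deriv F) z = deriv F1 z"
    by (rule deriv_cong_ev) simp
  also have "\<dots> = integral_along \<gamma> (\<lambda>\<tau>. (deriv ^^ 2) (\<lambda>w. h w \<tau>) z)"
    using tw U(2) unfolding twice_diff_under_integral_def F1_def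
    by (blast intro: DERIV_imp_deriv)
  also have "\<dots> = integral {0<..<1} (\<lambda>\<tau>. h2 z \<tau> * p \<tau>)"
    unfolding integral_along_def p_def by (rule integral_cong) (simp add: d2)
  finally have DDF: "(deriv ^^ 2) F z = integral {0<..<1} (\<lambda>\<tau>. h2 z \<tau> * p \<tau>)"
    by (simp add: numeral_2_eq_2)
  have DF': "deriv F z = integral {0<..<1} (\<lambda>\<tau>. h1 z \<tau> * p \<tau>)"
    unfolding DF[OF U(2)] F1_def integral_along_def p_def
    by (rule integral_cong) (simp add: d1 U)
  have F0: "F z = integral {0<..<1} (\<lambda>\<tau>. h z \<tau> * p \<tau>)"
    by (simp add: F_def integral_along_def p_def)
  have i0: "(\<lambda>\<tau>. h z \<tau> * p \<tau>) integrable_on {0<..<1}"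
    using conv[OF U(2)] by (simp add: converges_along_def p_def)
  have i1: "(\<lambda>\<tau>. h1 z \<tau> * p \<tau>) integrable_on {0<..<1}"
  proof (rule integrable_eq)
    show "(\<lambda>\<tau>. deriv (\<lambda>w. h w \<tau>) z * p \<tau>) integrable_on {0<..<1}"
      using tw U(2) by (simp add: twice_diff_under_integral_def converges_along_def p_def)
  qed (simp add: d1 U)
  have i2: "(\<lambda>\<tau>. h2 z \<tau> * p \<tau>) integrable_on {0<..<1}"
  proof (rule integrable_eq)
    show "(\<lambda>\<tau>. (deriv ^^ 2) (\<lambda>w. h w \<tau>) z * p \<tau>) integrable_on {0<..<1}"
      using tw U(2) by (simp add: twice_diff_under_integral_def converges_along_def p_def)
  qed (simp add: d2)
  define k where "k = (\<lambda>\<tau>. h2 z \<tau> - 2 * z * h1 z \<tau> - 2 * a * h z \<tau>)"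
  have "((\<lambda>\<tau>. h2 z \<tau> * p \<tau> - 2 * z * (h1 z \<tau> * p \<tau>) - 2 * a * (h z \<tau> * p \<tau>))
          has_integral ((deriv ^^ 2) F z - 2 * z * deriv F z - 2 * a * F z)) {0<..<1}"
    unfolding DDF DF' F0
    by (intro has_integral_diff has_integral_mult_right integrable_integral i0 i1 i2)
  then have *: "((\<lambda>\<tau>. k \<tau> * p \<tau>) has_integral hermite_op a F z) {0<..<1}"
    by (simp add: k_def hermite_op_def algebra_simps)
  have "integral_along \<gamma> k = 0"
  proof (rule integral_along_eq_boundary_diff[OF \<gamma> _ cont _ bd])
    show "converges_along \<gamma> k"
      using * unfolding converges_along_def p_def by (rule has_integral_integrable)
  qed (use exact in \<open>simp add: k_def\<close>)
  with * show ?thesis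
    unfolding F_def by (simp add: integral_along_def[of \<gamma> k] p_def integral_unique)
qed

section \<open>Differentiating a chosen logarithm\<close>

text \<open>
  By continuity, \<open>l\<close> stays near \<open>x\<close> within a strip of height \<open>2 \<pi>\<close> around \<open>l x\<close>, so that there
  \<open>l y = l x + Ln (g y / g x)\<close> with the principal logarithm.
\<close>

lemma has_derivative_log_branch:
  fixes l g :: "'a::real_normed_vector \<Rightarrow> complex"
  assumes cont: "isCont l x"
    and ev: "\<forall>\<^sub>F y in nhds x. exp (l y) = g y"
    and g: "(g has_derivative g') (at x)"
  shows "(l has_derivative (\<lambda>h. g' h / g x)) (at x)"
proof -
  have gx: "g x = exp (l x)" using eventually_nhds_x_imp_x[OF ev] by simp
  have "((\<lambda>y. Im (l y - l x)) \<longlongrightarrow> 0) (nhds x)"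
    using cont by (auto intro!: tendsto_eq_intros simp: continuous_at tendsto_at_iff_tendsto_nhds)
  then have "\<forall>\<^sub>F y in nhds x. dist (Im (l y - l x)) 0 < pi"
    by (rule tendstoD) simp
  with ev have eq: "\<forall>\<^sub>F y in nhds x. l x + Ln (g y / g x) = l y"
  proof eventually_elim
    case (elim y)
    have "g y / g x = exp (l y - l x)" using elim gx by (simp add: exp_diff)
    moreover have "Ln (exp (l y - l x)) = l y - l x"
      using elim(2) by (intro Ln_exp) (auto simp: dist_real_def)
    ultimately show ?case by simp
  qed
  have "((\<lambda>y. g y / g x) has_derivative (\<lambda>h. g' h / g x)) (at x)"
    using bounded_linear.has_derivative[OF bounded_linear_divide g] .
  moreover have "(Ln has_derivative (*) 1) (at (g x / g x))"
    using has_field_derivative_Ln[of 1] gx by (simp add: has_field_derivative_def)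
  ultimately have "((\<lambda>y. Ln (g y / g x)) has_derivative (\<lambda>h. 1 * (g' h / g x))) (at x)"
    by (rule has_derivative_compose)
  then have "((\<lambda>y. l x + Ln (g y / g x)) has_derivative (\<lambda>h. g' h / g x)) (at x)"
    by (auto intro: derivative_eq_intros)
  then show ?thesis
    by (rule has_derivative_transform_eventually)
      (use eq eventually_nhds_x_imp_x[OF eq] in \<open>auto simp: eventually_nhds_conv_at\<close>)
qed

lemma log_branch_has_vector_derivative:
  assumes l: "log_branch g l" and \<tau>: "\<tau> \<in> {0<..<1}"
    and g: "(g has_vector_derivative D) (at \<tau>)"
  shows "(l has_vector_derivative D / g \<tau>) (at \<tau>)"
proof -
  have "(l has_derivative (\<lambda>h. (h *\<^sub>R D) / g \<tau>)) (at \<tau>)"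
  proof (rule has_derivative_log_branch)
    show "isCont l \<tau>"
      using l \<tau> by (simp add: log_branch_def continuous_on_eq_continuous_at)
    show "\<forall>\<^sub>F y in nhds \<tau>. exp (l y) = g y"
      using l \<tau> unfolding log_branch_def eventually_nhds
      by (intro exI[of _ "{0<..<1}"]) auto
  qed (use g in \<open>simp add: has_vector_derivative_def\<close>)
  then show ?thesis
    by (simp add: has_vector_derivative_def scaleR_conv_of_real)
qed

section \<open>The two integral representations\<close>

text \<open>
  The product rule for \<open>c e^q g^b\<close>, with the lower power \<open>g^(b-1)\<close> factored out so that no
  quotient by \<open>g\<close> remains and the result can be compared with the integrand by polynomial algebra.
  The factor \<open>c\<close> stays in the primitive because it is \<open>-a\<close> in the first representation, which
  may be \<open>0\<close>.
\<close>

lemma has_vector_derivative_exp_times_power: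
  assumes l: "log_branch g l" and \<tau>: "\<tau> \<in> {0<..<1}"
    and g: "(g has_vector_derivative D) (at \<tau>)"
    and q: "(q has_vector_derivative E) (at \<tau>)"
  shows "((\<lambda>\<tau>. c * (exp (q \<tau>) * branch_power (l \<tau>) b)) has_vector_derivative
           c * exp (q \<tau>) * branch_power (l \<tau>) (b - 1) * (E * g \<tau> + b * D)) (at \<tau>)"
proof -
  have gt: "exp (l \<tau>) = g \<tau>" using l \<tau> by (simp add: log_branch_def)
  have g0: "g \<tau> \<noteq> 0" by (rule exp_not_eq_zero[of "l \<tau>", unfolded gt])
  have lower: "exp (b * l \<tau>) = exp ((b - 1) * l \<tau>) * g \<tau>"
    using gt g0 by (simp add: algebra_simps exp_diff)
  have "((\<lambda>\<tau>. q \<tau> + b * l \<tau>) has_vector_derivative E + b * (D / g \<tau>)) (at \<tau>)"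
    by (intro has_vector_derivative_add has_vector_derivative_mult_right q
        log_branch_has_vector_derivative[OF l \<tau> g])
  from field_vector_diff_chain_at[OF this DERIV_exp]
  have "((\<lambda>\<tau>. exp (q \<tau> + b * l \<tau>)) has_vector_derivative
          (E + b * (D / g \<tau>)) * exp (q \<tau> + b * l \<tau>)) (at \<tau>)"
    by (simp add: o_def)
  then have "((\<lambda>\<tau>. c * exp (q \<tau> + b * l \<tau>)) has_vector_derivative
          c * ((E + b * (D / g \<tau>)) * exp (q \<tau> + b * l \<tau>))) (at \<tau>)"
    by (rule has_vector_derivative_mult_right)
  moreover have "c * ((E + b * (D / g \<tau>)) * (exp (q \<tau>) * (x * g \<tau>)))
      = c * exp (q \<tau>) * x * (E * g \<tau> + b * D)" for x
    using g0 by (simp add: field_simps)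
  ultimately show ?thesis
    by (simp only: branch_power_def exp_add lower)
qed

lemma continuous_on_exp_times_power:
  assumes "log_branch g l" "continuous_on {0<..<1} q"
  shows "continuous_on {0<..<1} (\<lambda>\<tau>. c * (exp (q \<tau>) * branch_power (l \<tau>) b))"
  using assms unfolding branch_power_def log_branch_def by (intro continuous_intros) auto

lemma contour_continuous_on:
  assumes "contour \<gamma>"
  shows "continuous_on {0<..<1} \<gamma>"
proof -
  have "isCont \<gamma> x" if x: "0 < x" "x < 1" for x
  proof -
    have "\<gamma> piecewise_C1_differentiable_on {x/2..(x+1)/2}"
      using assms x by (simp add: contour_def)
    then have "continuous_on {x/2..(x+1)/2} \<gamma>"
      by (simp add: piecewise_C1_differentiable_on_def)
    then show ?thesis
      by (rule continuous_on_interior) (use x in simp)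
  qed
  then show ?thesis
    by (simp add: continuous_on_eq_continuous_at)
qed

lemma has_boundary_diff_cmult:
  "has_boundary_diff h D \<Longrightarrow> has_boundary_diff (\<lambda>\<tau>. c * h \<tau>) (c * D)"
  unfolding has_boundary_diff_def by (metis tendsto_mult_left right_diff_distrib)

theorem theorem7p1:
  fixes a :: complex and U :: "complex set" and \<gamma> :: "real \<Rightarrow> complex"
  assumes "open U" and "contour \<gamma>"
  shows
    "(\<forall>l :: complex \<Rightarrow> real \<Rightarrow> complex.
        (\<forall>\<tau>\<in>{0<..<1}. \<gamma> \<tau> \<notin> U) \<and>
        (\<forall>z\<in>U. log_branch (\<lambda>\<tau>. \<gamma> \<tau> - z) (l z)) \<and>
        (\<forall>\<tau>\<in>{0<..<1}. (\<lambda>z. l z \<tau>) holomorphic_on U) \<and>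
        (\<forall>z\<in>U. converges_along \<gamma> (\<lambda>\<tau>. exp ((\<gamma> \<tau>)\<^sup>2) * branch_power (l z \<tau>) (- a))) \<and>
        twice_diff_under_integral \<gamma> U
          (\<lambda>z \<tau>. exp ((\<gamma> \<tau>)\<^sup>2) * branch_power (l z \<tau>) (- a)) \<and>
        (\<forall>z\<in>U. has_boundary_diff
          (\<lambda>\<tau>. exp ((\<gamma> \<tau>)\<^sup>2) * branch_power (l z \<tau>) (- a - 1)) 0)
        \<longrightarrow> (\<forall>z\<in>U. hermite_op a
              (\<lambda>z. integral_along \<gamma>
                 (\<lambda>\<tau>. exp ((\<gamma> \<tau>)\<^sup>2) * branch_power (l z \<tau>) (- a))) z = 0))
     \<and>
     (\<forall>l :: real \<Rightarrow> complex.
        (\<forall>\<tau>\<in>{0<..<1}. \<gamma> \<tau> \<noteq> 0) \<and>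
        log_branch \<gamma> l \<and>
        (\<forall>z\<in>U. converges_along \<gamma>
          (\<lambda>\<tau>. exp (- (\<gamma> \<tau>)\<^sup>2 - 2 * z * \<gamma> \<tau>) * branch_power (l \<tau>) (a - 1))) \<and>
        twice_diff_under_integral \<gamma> U
          (\<lambda>z \<tau>. exp (- (\<gamma> \<tau>)\<^sup>2 - 2 * z * \<gamma> \<tau>) * branch_power (l \<tau>) (a - 1)) \<and>
        (\<forall>z\<in>U. has_boundary_diff
          (\<lambda>\<tau>. exp (- (\<gamma> \<tau>)\<^sup>2 - 2 * z * \<gamma> \<tau>) * branch_power (l \<tau>) a) 0)
        \<longrightarrow> (\<forall>z\<in>U. hermite_op a
              (\<lambda>z. integral_along \<gamma>
                 (\<lambda>\<tau>. exp (- (\<gamma> \<tau>)\<^sup>2 - 2 * z * \<gamma> \<tau>) * branch_power (l \<tau>) (a - 1))) z = 0))"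
proof (intro conjI allI impI ballI; elim conjE)
  note \<gamma> = \<open>contour \<gamma>\<close>
  have cont: "continuous_on {0<..<1} \<gamma>"
    by (rule contour_continuous_on[OF \<gamma>])
  {
    fix l :: "complex \<Rightarrow> real \<Rightarrow> complex" and z
    assume l: "\<forall>z\<in>U. log_branch (\<lambda>\<tau>. \<gamma> \<tau> - z) (l z)"
      and hol: "\<forall>\<tau>\<in>{0<..<1}. (\<lambda>z. l z \<tau>) holomorphic_on U"
      and conv: "\<forall>z\<in>U. converges_along \<gamma> (\<lambda>\<tau>. exp ((\<gamma> \<tau>)\<^sup>2) * branch_power (l z \<tau>) (- a))"
      and tw: "twice_diff_under_integral \<gamma> U (\<lambda>z \<tau>. exp ((\<gamma> \<tau>)\<^sup>2) * branch_power (l z \<tau>) (- a))"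
      and bd: "\<forall>z\<in>U. has_boundary_diff (\<lambda>\<tau>. exp ((\<gamma> \<tau>)\<^sup>2) * branch_power (l z \<tau>) (- a - 1)) 0"
      and z: "z \<in> U"
    have el: "exp (l w \<tau>) = \<gamma> \<tau> - w" if "w \<in> U" "\<tau> \<in> {0<..<1}" for w \<tau>
      using l that by (simp add: log_branch_def)
    have power: "((\<lambda>w. c * (exp ((\<gamma> \<tau>)\<^sup>2) * branch_power (l w \<tau>) b)) has_field_derivative
                    (- b * c) * (exp ((\<gamma> \<tau>)\<^sup>2) * branch_power (l w \<tau>) (b - 1))) (at w)"
      if w: "w \<in> U" "\<tau> \<in> {0<..<1}" for c b w \<tau>
    proof -
      have "((\<lambda>w. l w \<tau>) has_derivative (\<lambda>h. (- h) / (\<gamma> \<tau> - w))) (at w)"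
      proof (rule has_derivative_log_branch)
        show "isCont (\<lambda>w. l w \<tau>) w"
          using hol w \<open>open U\<close> holomorphic_on_imp_continuous_on continuous_on_eq_continuous_at
          by blast
        show "\<forall>\<^sub>F w in nhds w. exp (l w \<tau>) = \<gamma> \<tau> - w"
          unfolding eventually_nhds using \<open>open U\<close> w el by blast
      qed (auto intro!: derivative_eq_intros)
      then have "((\<lambda>w. l w \<tau>) has_field_derivative (- 1 / (\<gamma> \<tau> - w))) (at w)"
        by (rule has_derivative_imp_has_field_derivative) simp
      then have "((\<lambda>w. c * (exp ((\<gamma> \<tau>)\<^sup>2) * exp (b * l w \<tau>))) has_field_derivative
          c * (exp ((\<gamma> \<tau>)\<^sup>2) * (exp (b * l w \<tau>) * (b * (- 1 / (\<gamma> \<tau> - w)))))) (at w)"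
        by (auto intro!: derivative_eq_intros)
      moreover have "exp ((b - 1) * l w \<tau>) = exp (b * l w \<tau>) / (\<gamma> \<tau> - w)"
        using el[OF w] by (simp add: left_diff_distrib exp_diff)
      ultimately show ?thesis
        by (simp add: branch_power_def mult_ac)
    qed
    show "hermite_op a (\<lambda>z. integral_along \<gamma>
            (\<lambda>\<tau>. exp ((\<gamma> \<tau>)\<^sup>2) * branch_power (l z \<tau>) (- a))) z = 0"
    proof (rule hermite_op_integral_along_exact[OF \<open>open U\<close> z \<gamma> _ tw])
      fix w \<tau> assume w: "w \<in> U" "\<tau> \<in> {0<..<1::real}"
      show "((\<lambda>w. exp ((\<gamma> \<tau>)\<^sup>2) * branch_power (l w \<tau>) (- a)) has_field_derivative
              a * (exp ((\<gamma> \<tau>)\<^sup>2) * branch_power (l w \<tau>) (- a - 1))) (at w)"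
        using power[OF w, of 1 "- a"] by simp
      show "((\<lambda>w. a * (exp ((\<gamma> \<tau>)\<^sup>2) * branch_power (l w \<tau>) (- a - 1))) has_field_derivative
              (a + 1) * a * (exp ((\<gamma> \<tau>)\<^sup>2) * branch_power (l w \<tau>) (- a - 2))) (at w)"
        using power[OF w, of a "- a - 1"] by (simp add: algebra_simps)
    next
      show "continuous_on {0<..<1} (\<lambda>\<tau>. (- a) * (exp ((\<gamma> \<tau>)\<^sup>2) * branch_power (l z \<tau>) (- a - 1)))"
        using l z cont by (intro continuous_on_exp_times_power continuous_intros) auto
    next
      show "has_boundary_diff (\<lambda>\<tau>. (- a) * (exp ((\<gamma> \<tau>)\<^sup>2) * branch_power (l z \<tau>) (- a - 1))) 0"
        using has_boundary_diff_cmult[of _ 0 "- a"] bd z by simp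
    next
      fix \<tau> D assume \<tau>: "\<tau> \<in> {0<..<1::real}" and D: "(\<gamma> has_vector_derivative D) (at \<tau>)"
      \<comment> \<open>With every power written in terms of the lowest one, exactness is a polynomial identity.\<close>
      define P where "P = branch_power (l z \<tau>) (- a - 2)"
      have P1: "branch_power (l z \<tau>) (- a - 1) = P * (\<gamma> \<tau> - z)"
        unfolding P_def branch_power_def el[OF z \<tau>, symmetric] exp_add[symmetric]
        by (rule arg_cong[where f = exp]) (simp add: algebra_simps)
      have P0: "branch_power (l z \<tau>) (- a) = P * (\<gamma> \<tau> - z) * (\<gamma> \<tau> - z)"
        unfolding P_def branch_power_def el[OF z \<tau>, symmetric] exp_add[symmetric]
        by (rule arg_cong[where f = exp]) (simp add: algebra_simps)
      have sq: "((\<lambda>\<tau>. (\<gamma> \<tau>)\<^sup>2) has_vector_derivative 2 * \<gamma> \<tau> * D) (at \<tau>)"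
        using has_vector_derivative_mult[OF D D] by (simp add: power2_eq_square mult_ac)
      have D': "((\<lambda>\<tau>. \<gamma> \<tau> - z) has_vector_derivative D) (at \<tau>)"
        using has_vector_derivative_diff[OF D has_vector_derivative_const[of z]] by simp
      have "- a - 1 - 1 = - a - 2" by simp
      with has_vector_derivative_exp_times_power[OF l[rule_format, OF z] \<tau> D' sq,
          of "- a" "- a - 1"]
      have "((\<lambda>\<tau>. (- a) * (exp ((\<gamma> \<tau>)\<^sup>2) * branch_power (l z \<tau>) (- a - 1))) has_vector_derivative
           (- a) * exp ((\<gamma> \<tau>)\<^sup>2) * P * (2 * \<gamma> \<tau> * D * (\<gamma> \<tau> - z) + (- a - 1) * D)) (at \<tau>)"
        by (simp only: P_def)
      moreover have "(- a) * exp ((\<gamma> \<tau>)\<^sup>2) * P * (2 * \<gamma> \<tau> * D * (\<gamma> \<tau> - z) + (- a - 1) * D)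
        = ((a + 1) * a * (exp ((\<gamma> \<tau>)\<^sup>2) * P) - 2 * z * (a * (exp ((\<gamma> \<tau>)\<^sup>2) * (P * (\<gamma> \<tau> - z))))
           - 2 * a * (exp ((\<gamma> \<tau>)\<^sup>2) * (P * (\<gamma> \<tau> - z) * (\<gamma> \<tau> - z)))) * D"
        by algebra
      ultimately show "((\<lambda>\<tau>. (- a) * (exp ((\<gamma> \<tau>)\<^sup>2) * branch_power (l z \<tau>) (- a - 1)))
          has_vector_derivative
          ((a + 1) * a * (exp ((\<gamma> \<tau>)\<^sup>2) * branch_power (l z \<tau>) (- a - 2))
           - 2 * z * (a * (exp ((\<gamma> \<tau>)\<^sup>2) * branch_power (l z \<tau>) (- a - 1)))
           - 2 * a * (exp ((\<gamma> \<tau>)\<^sup>2) * branch_power (l z \<tau>) (- a))) * D) (at \<tau>)"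
        by (simp only: P0 P1 P_def[symmetric])
    qed (use conv in blast)
  next
    fix l :: "real \<Rightarrow> complex" and z
    assume l: "log_branch \<gamma> l"
      and conv: "\<forall>z\<in>U. converges_along \<gamma>
          (\<lambda>\<tau>. exp (- (\<gamma> \<tau>)\<^sup>2 - 2 * z * \<gamma> \<tau>) * branch_power (l \<tau>) (a - 1))"
      and tw: "twice_diff_under_integral \<gamma> U
          (\<lambda>z \<tau>. exp (- (\<gamma> \<tau>)\<^sup>2 - 2 * z * \<gamma> \<tau>) * branch_power (l \<tau>) (a - 1))"
      and bd: "\<forall>z\<in>U. has_boundary_diff
          (\<lambda>\<tau>. exp (- (\<gamma> \<tau>)\<^sup>2 - 2 * z * \<gamma> \<tau>) * branch_power (l \<tau>) a) 0"
      and z: "z \<in> U"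
    show "hermite_op a (\<lambda>z. integral_along \<gamma>
            (\<lambda>\<tau>. exp (- (\<gamma> \<tau>)\<^sup>2 - 2 * z * \<gamma> \<tau>) * branch_power (l \<tau>) (a - 1))) z = 0"
    proof (rule hermite_op_integral_along_exact[OF \<open>open U\<close> z \<gamma> _ tw])
      fix w \<tau>
      show "((\<lambda>w. exp (- (\<gamma> \<tau>)\<^sup>2 - 2 * w * \<gamma> \<tau>) * branch_power (l \<tau>) (a - 1)) has_field_derivative
              - 2 * \<gamma> \<tau> * (exp (- (\<gamma> \<tau>)\<^sup>2 - 2 * w * \<gamma> \<tau>) * branch_power (l \<tau>) (a - 1))) (at w)"
        by (auto intro!: derivative_eq_intros)
      show "((\<lambda>w. - 2 * \<gamma> \<tau> * (exp (- (\<gamma> \<tau>)\<^sup>2 - 2 * w * \<gamma> \<tau>) * branch_power (l \<tau>) (a - 1)))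
              has_field_derivative
              4 * (\<gamma> \<tau>)\<^sup>2 * (exp (- (\<gamma> \<tau>)\<^sup>2 - 2 * w * \<gamma> \<tau>) * branch_power (l \<tau>) (a - 1))) (at w)"
        by (auto intro!: derivative_eq_intros simp: power2_eq_square)
    next
      show "continuous_on {0<..<1}
              (\<lambda>\<tau>. (- 2) * (exp (- (\<gamma> \<tau>)\<^sup>2 - 2 * z * \<gamma> \<tau>) * branch_power (l \<tau>) a))"
        using cont by (intro continuous_on_exp_times_power[OF l] continuous_intros)
    next
      show "has_boundary_diff
              (\<lambda>\<tau>. (- 2) * (exp (- (\<gamma> \<tau>)\<^sup>2 - 2 * z * \<gamma> \<tau>) * branch_power (l \<tau>) a)) 0"
        using has_boundary_diff_cmult[of _ 0 "- 2"] bd z by simp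
    next
      fix \<tau> D assume \<tau>: "\<tau> \<in> {0<..<1::real}" and D: "(\<gamma> has_vector_derivative D) (at \<tau>)"
      have "((\<lambda>\<tau>. - (\<gamma> \<tau> * \<gamma> \<tau>) - 2 * z * \<gamma> \<tau>) has_vector_derivative
              - (\<gamma> \<tau> * D + D * \<gamma> \<tau>) - 2 * z * D) (at \<tau>)"
        by (intro has_vector_derivative_diff has_vector_derivative_minus
            has_vector_derivative_mult has_vector_derivative_mult_right D)
      then have "((\<lambda>\<tau>. - (\<gamma> \<tau>)\<^sup>2 - 2 * z * \<gamma> \<tau>) has_vector_derivative
              - (\<gamma> \<tau> * D + D * \<gamma> \<tau>) - 2 * z * D) (at \<tau>)"
        by (simp only: power2_eq_square)
      from has_vector_derivative_exp_times_power[OF l \<tau> D this, of "- 2" a]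
      show "((\<lambda>\<tau>. (- 2) * (exp (- (\<gamma> \<tau>)\<^sup>2 - 2 * z * \<gamma> \<tau>) * branch_power (l \<tau>) a))
              has_vector_derivative
              (4 * (\<gamma> \<tau>)\<^sup>2 * (exp (- (\<gamma> \<tau>)\<^sup>2 - 2 * z * \<gamma> \<tau>) * branch_power (l \<tau>) (a - 1))
               - 2 * z * (- 2 * \<gamma> \<tau> * (exp (- (\<gamma> \<tau>)\<^sup>2 - 2 * z * \<gamma> \<tau>) * branch_power (l \<tau>) (a - 1)))
               - 2 * a * (exp (- (\<gamma> \<tau>)\<^sup>2 - 2 * z * \<gamma> \<tau>) * branch_power (l \<tau>) (a - 1))) * D) (at \<tau>)"
        by (rule has_vector_derivative_eq_rhs) algebra
    qed (use conv in blast)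
  }
qed

end
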